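(* Let $S$ be a finite $E$-unitary inverse semigroup acting on a ring $A$ via a unital injective action $\beta=(A_s,\beta_s)_{s\in S}$. Let $\mathrm{tr}^{\sigma}_\beta:A\to A$ be the $\sigma$-trace map $$\mathrm{tr}^\sigma_\beta(a)=\sum_{g\in S/\sigma}\alpha_g(a1_{g^{-1}}),$$ where $\alpha=(A_g,\alpha_g)_{g\in S/\sigma}$ is the partial action of the group $S/\sigma$ on $A$ induced by $\beta$. Then $\mathrm{tr}^\sigma_\beta$ is a homomorphism of $A^\beta$-bimodules. Furthermore, $\mathrm{tr}^\sigma_\beta(A)\subseteq A^\beta$ and $\mathrm{tr}^\sigma_\beta(\beta_s(a))=\mathrm{tr}^\sigma_\beta(a)$ for all $s\in S$ and $a\in A_{s^{-1}}$.
   Context: Rings are associative. An inverse semigroup is a semigroup $S$ in which every $s$ has a unique $s^{-1}$ with $ss^{-1}s=s$, $s^{-1}ss^{-1}=s^{-1}$; $E(S)$ is its set of idempotents. Natural partial order: $s\preceq t$ iff $s=tf$ for some $f\in E(S)$. $S$ is $E$-unitary if $e\in E(S)$ and $e\preceq s$ imply $s\in E(S)$. The relation $s\,\sigma\,t$ iff there is $u\in S$ with $u\preceq s,t$ is the minimum group congruence of $S$, so $S/\sigma$ is a group; $\sigma(s)$ is the class of $s$. Action: $A$ is an algebra over a fixed commutative ring $k$. An action of $S$ on $A$ is a collection $\beta=(A_s,\beta_s)_{s\in S}$ of two-sided ideals $A_s$ of $A$ and $k$-algebra isomorphisms $\beta_s:A_{s^{-1}}\to A_s$ such that $A=\sum_{e\in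 E(S)}A_e$ and $\beta_s(\beta_t(a))=\beta_{st}(a)$ for all $s,t\in S$ and $a\in A_{(st)^{-1}}=\beta_t^{-1}(A_t\cap A_{s^{-1}})$. It is unital if each $A_s$ is generated by a central idempotent $1_s$ of $A$, and injective if $\beta_{s}=\beta_{t}$ implies $s=t$. The subring of invariants is $A^\beta=\{a\in A:\beta_s(a1_{s^{-1}})=a1_s\text{ for all }s\in S\}$. Induced partial action: $A_{\sigma(s)}=\sum_{t\in\sigma(s)}A_t$, and $\alpha_{\sigma(s)}:A_{\sigma(s)^{-1}}\to A_{\sigma(s)}$ sends $\sum_{t\in\sigma(s)}x_t$ (with $x_t\in A_{t^{-1}}$) to $\sum_{t\in\sigma(s)}\beta_t(x_t)$; these data are well defined and form a unital partial action of the group $S/\sigma$ on $A$, and $1_g$ denotes the identity element of the ideal $A_g$. *)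

theory Defs
  imports Complex_Main
begin

section \<open>Inverse semigroups\<close>

class inverse_semigroup = semigroup_mult +
  assumes ex1_inverse: "\<exists>!t. s * t * s = s \<and> t * s * t = t"
begin

definition sinv :: "'a \<Rightarrow> 'a" where
  "sinv s = (THE t. s * t * s = s \<and> t * s * t = t)"

definition idempotents :: "'a set" where
  "idempotents = {e. e * e = e}"

definition natural_le :: "'a \<Rightarrow> 'a \<Rightarrow> bool"  (infix "\<preceq>" 50) where
  "s \<preceq> t \<longleftrightarrow> (\<exists>f\<in>idempotents. s = t * f)"

definition min_group_cong :: "('a \<times> 'a) set" where
  "min_group_cong = {(s, t). \<exists>u. u \<preceq> s \<and> u \<preceq> t}"

definition min_group :: "'a set set" where
  "min_group = UNIV // min_group_cong"

definition class_inv :: "'a set \<Rightarrow> 'a set" where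
  "class_inv g = (\<Union>s\<in>g. min_group_cong `` {sinv s})"

end

class e_unitary_inverse_semigroup = inverse_semigroup +
  assumes e_unitary: "e \<in> idempotents \<Longrightarrow> e \<preceq> s \<Longrightarrow> s \<in> idempotents"


section \<open>Algebras and ideals\<close>

text \<open>Associative algebras, not assumed to have an identity element.\<close>

locale assoc_algebra = module scale
  for scale :: "'k::comm_ring_1 \<Rightarrow> 'a::ring \<Rightarrow> 'a" +
  assumes scale_mult_left: "scale r (x * y) = scale r x * y"
    and scale_mult_right: "scale r (x * y) = x * scale r y"

definition two_sided_ideal :: "('k::comm_ring_1 \<Rightarrow> 'a::ring \<Rightarrow> 'a) \<Rightarrow> 'a set \<Rightarrow> bool" where
  "two_sided_ideal scale I \<longleftrightarrow>
     module.subspace scale I \<and> (\<forall>x\<in>I. \<forall>a. a * x \<in> I \<and> x * a \<in> I)"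

definition central_idempotent :: "'a::ring \<Rightarrow> bool" where
  "central_idempotent e \<longleftrightarrow> e * e = e \<and> (\<forall>a. e * a = a * e)"

definition generates_ideal ::
    "('k::comm_ring_1 \<Rightarrow> 'a::ring \<Rightarrow> 'a) \<Rightarrow> 'a \<Rightarrow> 'a set \<Rightarrow> bool" where
  "generates_ideal scale e I \<longleftrightarrow> I = two_sided_ideal scale hull {e}"

text \<open>A central idempotent generating an ideal is its identity element, hence unique.\<close>

definition generating_idempotent ::
    "('k::comm_ring_1 \<Rightarrow> 'a::ring \<Rightarrow> 'a) \<Rightarrow> 'a set \<Rightarrow> 'a" where
  "generating_idempotent scale I = (THE e. central_idempotent e \<and> generates_ideal scale e I)"

definition identity_of :: "'a::ring set \<Rightarrow> 'a" where
  "identity_of I = (THE e. e \<in> I \<and> (\<forall>x\<in>I. e * x = x \<and> x * e = x))"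

definition ideal_sum :: "('i \<Rightarrow> 'a::ring set) \<Rightarrow> 'i set \<Rightarrow> 'a set" where
  "ideal_sum A T = {\<Sum>t\<in>F. x t | F x. finite F \<and> F \<subseteq> T \<and> (\<forall>t\<in>F. x t \<in> A t)}"

definition bimodule_hom_over :: "'a::ring set \<Rightarrow> ('a \<Rightarrow> 'a) \<Rightarrow> bool" where
  "bimodule_hom_over R f \<longleftrightarrow>
     (\<forall>x y. f (x + y) = f x + f y) \<and>
     (\<forall>r\<in>R. \<forall>x. f (r * x) = r * f x \<and> f (x * r) = f x * r)"


section \<open>Actions of inverse semigroups\<close>

text \<open>The map \<open>\<beta> s\<close> is a total function of which only the restriction to \<open>A (sinv s)\<close> is
  meaningful.\<close>

locale inverse_semigroup_action = assoc_algebra scale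
  for scale :: "'k::comm_ring_1 \<Rightarrow> 'a::ring \<Rightarrow> 'a" +
  fixes A :: "'s::inverse_semigroup \<Rightarrow> 'a set"
    and \<beta> :: "'s \<Rightarrow> 'a \<Rightarrow> 'a"
  assumes ideal: "two_sided_ideal scale (A s)"
    and bij: "bij_betw (\<beta> s) (A (sinv s)) (A s)"
    and map_add: "\<lbrakk>a \<in> A (sinv s); b \<in> A (sinv s)\<rbrakk> \<Longrightarrow> \<beta> s (a + b) = \<beta> s a + \<beta> s b"
    and map_mult: "\<lbrakk>a \<in> A (sinv s); b \<in> A (sinv s)\<rbrakk> \<Longrightarrow> \<beta> s (a * b) = \<beta> s a * \<beta> s b"
    and map_scale: "a \<in> A (sinv s) \<Longrightarrow> \<beta> s (scale r a) = scale r (\<beta> s a)"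
    and sum_idempotents: "ideal_sum A idempotents = UNIV"
    and domain_mult: "A (sinv (s * t)) = {a \<in> A (sinv t). \<beta> t a \<in> A t \<inter> A (sinv s)}"
    and map_comp: "a \<in> A (sinv (s * t)) \<Longrightarrow> \<beta> s (\<beta> t a) = \<beta> (s * t) a"

definition unital_action ::
    "('k::comm_ring_1 \<Rightarrow> 'a::ring \<Rightarrow> 'a) \<Rightarrow> ('s::inverse_semigroup \<Rightarrow> 'a set) \<Rightarrow> bool" where
  "unital_action scale A \<longleftrightarrow> (\<forall>s. \<exists>e. central_idempotent e \<and> generates_ideal scale e (A s))"

text \<open>Injectivity of \<open>s \<mapsto> \<beta> s\<close>, where \<open>\<beta> s\<close> and \<open>\<beta> t\<close> are compared as maps
  \<open>A (sinv s) \<rightarrow> A s\<close> and \<open>A (sinv t) \<rightarrow> A t\<close>.\<close>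

definition injective_action ::
    "('s::inverse_semigroup \<Rightarrow> 'a::ring set) \<Rightarrow> ('s \<Rightarrow> 'a \<Rightarrow> 'a) \<Rightarrow> bool" where
  "injective_action A \<beta> \<longleftrightarrow>
     (\<forall>s t. A (sinv s) = A (sinv t) \<and> A s = A t \<and> (\<forall>a\<in>A (sinv s). \<beta> s a = \<beta> t a) \<longrightarrow> s = t)"

definition invariants ::
    "('k::comm_ring_1 \<Rightarrow> 'a::ring \<Rightarrow> 'a) \<Rightarrow> ('s::inverse_semigroup \<Rightarrow> 'a set) \<Rightarrow>
     ('s \<Rightarrow> 'a \<Rightarrow> 'a) \<Rightarrow> 'a set" where
  "invariants scale A \<beta> =
     {a. \<forall>s. \<beta> s (a * generating_idempotent scale (A (sinv s))) =
              a * generating_idempotent scale (A s)}"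


section \<open>The induced partial action and the trace\<close>

definition induced_ideal :: "('s::inverse_semigroup \<Rightarrow> 'a::ring set) \<Rightarrow> 's set \<Rightarrow> 'a set" where
  "induced_ideal A g = ideal_sum A g"

text \<open>\<open>induced_map A \<beta> g\<close> is meaningful on \<open>induced_ideal A (class_inv g)\<close>, when \<open>g\<close> is an
  element of \<open>min_group\<close>.\<close>

definition induced_map ::
    "('s::inverse_semigroup \<Rightarrow> 'a::ring set) \<Rightarrow> ('s \<Rightarrow> 'a \<Rightarrow> 'a) \<Rightarrow> 's set \<Rightarrow> 'a \<Rightarrow> 'a" where
  "induced_map A \<beta> g a =
     (THE b. \<exists>F x. finite F \<and> F \<subseteq> g \<and> (\<forall>t\<in>F. x t \<in> A (sinv t)) \<and>
        a = (\<Sum>t\<in>F. x t) \<and> b = (\<Sum>t\<in>F. \<beta> t (x t)))"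

definition sigma_trace ::
    "('s::inverse_semigroup \<Rightarrow> 'a::ring set) \<Rightarrow> ('s \<Rightarrow> 'a \<Rightarrow> 'a) \<Rightarrow> 'a \<Rightarrow> 'a" where
  "sigma_trace A \<beta> a =
     (\<Sum>g\<in>min_group.
        induced_map A \<beta> g (a * identity_of (induced_ideal A (class_inv g))))"

end

theory Submission
  imports Defs
begin

text \<open>
  Let \<open>1\<^sub>s\<close> be the central idempotent generating \<open>A s\<close>, and extend \<open>\<beta> s\<close> to all of \<open>A\<close> by
  \<open>B\<^sub>s a = \<beta> s (1\<^bsub>s\<inverse>\<^esub> a)\<close> (\<open>ext_map\<close> below). The domain and composition conditions of an
  action make these total maps compose without restriction: \<open>B\<^sub>s B\<^sub>t = B\<^bsub>st\<^esub>\<close> (\<open>ext_comp\<close>), and for an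
  idempotent \<open>e\<close> the map \<open>B\<^sub>e\<close> is multiplication by \<open>1\<^sub>e\<close>. Hence \<open>1\<^sub>r B\<^sub>t = B\<^bsub>rr\<inverse>t\<^esub>\<close>, and every
  identity between products of \<open>1\<close>'s and \<open>B\<close>'s becomes an identity in the semigroup. An element
  \<open>a\<close> is invariant iff \<open>B\<^sub>s a = 1\<^sub>s a\<close> for all \<open>s\<close>.

  Being \<open>E\<close>-unitary enters once. If \<open>r \<sigma> t\<close>, then \<open>r t\<inverse>\<close> and \<open>r\<inverse> t\<close> are idempotent, so
  \<open>r r\<inverse> t = r t\<inverse> t\<close> (\<open>min_group_cong_meet\<close>), that is \<open>1\<^sub>r B\<^sub>t x = B\<^sub>r x\<close> for \<open>x \<in> A (t\<inverse>)\<close>.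
  For a class \<open>g\<close> and \<open>b = \<Sum>\<^sub>t B\<^sub>t x\<^sub>t\<close> with \<open>t \<in> g\<close> and \<open>x\<^sub>t \<in> A (t\<inverse>)\<close> this gives
  \<open>1\<^sub>r b = B\<^sub>r (\<Sum>\<^sub>t x\<^sub>t)\<close> for every \<open>r \<in> g\<close>. A finite sum of the ideals \<open>A t\<close> has an identity
  element that is a polynomial in the \<open>1\<^sub>t\<close> without constant term, so an element \<open>b\<close> of the sum is
  determined by its products \<open>1\<^sub>t b\<close> (\<open>ideal_sum_eqI\<close>). So the induced map of \<open>g\<close> is well
  defined, and \<open>T\<^sub>g a = \<alpha>\<^sub>g (a 1\<^bsub>g\<inverse>\<^esub>)\<close> is the only element \<open>b\<close> of \<open>A\<^sub>g\<close> with \<open>1\<^sub>r b = B\<^sub>r a\<close> for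
  all \<open>r \<in> g\<close>.

  All claims are checked on this characterisation. Since the \<open>B\<^sub>r\<close> are additive and linear over
  the invariants, so is \<open>T\<^sub>g\<close>. Moreover, with \<open>h\<close> the class of \<open>s\<close>, one has
  \<open>B\<^sub>s (T\<^sub>g a) = 1\<^sub>s T\<^bsub>hg\<^esub> a\<close> for every \<open>a\<close>, and \<open>T\<^sub>g (\<beta> s a) = T\<^bsub>gh\<^esub> a\<close> for \<open>a \<in> A (s\<inverse>)\<close>.
  Summing over \<open>g\<close> and using that left and right translation by \<open>h\<close> permute the group gives the
  invariance of the trace and its compatibility with \<open>\<beta> s\<close>.
\<close>


section \<open>Inverse semigroups\<close>

context inverse_semigroup
begin

lemma mult_sinv_mult [simp]: "s * sinv s * s = s"
  and sinv_mult_sinv [simp]: "sinv s * s * sinv s = sinv s"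
  using theI'[OF ex1_inverse[of s]] by (auto simp: sinv_def)

lemma sinv_unique: "s * t * s = s \<Longrightarrow> t * s * t = t \<Longrightarrow> sinv s = t"
  using ex1_inverse[of s] by (metis mult_sinv_mult sinv_mult_sinv)

lemma sinv_sinv [simp]: "sinv (sinv s) = s"
  by (rule sinv_unique) simp_all

lemma mult_sinv_mult_left [simp]: "s * (sinv s * s) = s"
  and sinv_mult_sinv_left [simp]: "sinv s * (s * sinv s) = sinv s"
  by (simp_all add: mult.assoc[symmetric])

lemma cancel_left [simp]: "s * (sinv s * (s * t)) = s * t"
  "sinv s * (s * (sinv s * t)) = sinv s * t"
  by (metis mult.assoc mult_sinv_mult sinv_mult_sinv)+

lemma idempotentsD: "e \<in> idempotents \<Longrightarrow> e * e = e"
  by (simp add: idempotents_def)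

lemma idempotents_absorb: "e \<in> idempotents \<Longrightarrow> e * (e * s) = e * s"
  by (simp add: idempotents_def mult.assoc[symmetric])

lemma sinv_idempotent: "e \<in> idempotents \<Longrightarrow> sinv e = e"
  by (rule sinv_unique) (simp_all add: idempotentsD)

lemma mult_sinv_idempotent [simp]: "s * sinv s \<in> idempotents" "sinv s * s \<in> idempotents"
  by (simp_all add: idempotents_def mult.assoc)

text \<open>The inverse \<open>x\<close> of \<open>e * f\<close> equals \<open>f * x * e\<close>, by uniqueness. This makes \<open>x\<close> idempotent, so
  \<open>x\<close> is its own inverse, and \<open>e * f\<close>, being the inverse of \<open>x\<close>, is equal to \<open>x\<close>.\<close>

lemma idempotents_mult:
  assumes e: "e \<in> idempotents" and f: "f \<in> idempotents"
  shows "e * f \<in> idempotents"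
proof -
  define x where "x = sinv (e * f)"
  have 1: "e * (f * (x * (e * f))) = e * f"
    using mult_sinv_mult[of "e * f"] by (simp add: x_def mult.assoc)
  have 2: "x * (e * (f * x)) = x"
    using sinv_mult_sinv[of "e * f"] by (simp add: x_def mult.assoc)
  have 3: "x * (e * (f * (x * e))) = x * e"
    using 2 by (metis mult.assoc)
  have fxe: "x = f * x * e"
    unfolding x_def
  proof (rule sinv_unique)
    show "e * f * (f * sinv (e * f) * e) * (e * f) = e * f"
      using 1 by (simp add: mult.assoc x_def idempotents_absorb e f)
    show "f * sinv (e * f) * e * (e * f) * (f * sinv (e * f) * e) = f * sinv (e * f) * e"
      using 3 by (simp add: mult.assoc x_def idempotents_absorb e f)
  qed
  have "x * x = f * (x * (e * (f * (x * e))))"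
    by (subst (1 2) fxe) (simp add: mult.assoc)
  also have "\<dots> = x"
    unfolding 3 using fxe by (metis mult.assoc)
  finally have "x \<in> idempotents"
    by (simp add: idempotents_def)
  moreover from this have "e * f = x"
    using sinv_idempotent[of x] by (simp add: x_def)
  ultimately show ?thesis by simp
qed

text \<open>The products \<open>e * f\<close> and \<open>f * e\<close> are both idempotent, hence inverse to each other, while an
  idempotent is its own inverse.\<close>

lemma idempotents_commute:
  assumes e: "e \<in> idempotents" and f: "f \<in> idempotents"
  shows "e * f = f * e"
proof -
  have ef: "e * f \<in> idempotents" and fe: "f * e \<in> idempotents"
    using idempotents_mult e f by auto
  have "sinv (e * f) = f * e"
    using idempotentsD[OF ef] idempotentsD[OF fe]
    by (intro sinv_unique) (simp_all add: mult.assoc idempotents_absorb e f)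
  then show ?thesis
    using sinv_idempotent[OF ef] by simp
qed

lemma idempotents_commute_left:
  "e \<in> idempotents \<Longrightarrow> f \<in> idempotents \<Longrightarrow> e * (f * s) = f * (e * s)"
  by (metis idempotents_commute mult.assoc)

lemma sinv_mult: "sinv (s * t) = sinv t * sinv s"
proof (rule sinv_unique)
  have c: "(t * sinv t) * (sinv s * s) = (sinv s * s) * (t * sinv t)"
    by (rule idempotents_commute) simp_all
  have "s * t * (sinv t * sinv s) * (s * t) = s * ((t * sinv t) * (sinv s * s)) * t"
    by (simp add: mult.assoc)
  then show "s * t * (sinv t * sinv s) * (s * t) = s * t"
    unfolding c by (simp add: mult.assoc)
  have "sinv t * sinv s * (s * t) * (sinv t * sinv s)
      = sinv t * ((sinv s * s) * (t * sinv t)) * sinv s"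
    by (simp add: mult.assoc)
  then show "sinv t * sinv s * (s * t) * (sinv t * sinv s) = sinv t * sinv s"
    unfolding c[symmetric] by (simp add: mult.assoc)
qed

lemma conj_idempotent:
  assumes "e \<in> idempotents"
  shows "s * e * sinv s \<in> idempotents"
proof -
  have "e * (sinv s * (s * (e * sinv s))) = e * ((sinv s * s) * (e * sinv s))"
    by (simp add: mult.assoc)
  also have "\<dots> = (sinv s * s) * (e * (e * sinv s))"
    by (rule idempotents_commute_left) (simp_all add: assms)
  also have "\<dots> = sinv s * (s * (e * sinv s))"
    by (simp add: idempotents_absorb[OF assms] mult.assoc)
  finally show ?thesis
    by (simp add: idempotents_def mult.assoc)
qed

lemma idempotent_mult_eq: "e \<in> idempotents \<Longrightarrow> e * s = s * (sinv s * e * s)"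
  using idempotents_commute[of e "s * sinv s"] by (metis mult.assoc mult_sinv_idempotent(1) mult_sinv_mult)

lemma mult_idempotent_eq: "e \<in> idempotents \<Longrightarrow> s * e = (s * e * sinv s) * s"
  using idempotents_commute[of e "sinv s * s"] by (metis mult.assoc mult_sinv_idempotent(2) mult_sinv_mult)

lemma natural_le_left: "u \<preceq> s \<longleftrightarrow> (\<exists>e\<in>idempotents. u = e * s)"
  unfolding natural_le_def
  by (metis mult_idempotent_eq idempotent_mult_eq conj_idempotent sinv_sinv)

lemma natural_le_refl: "s \<preceq> s"
  unfolding natural_le_def using mult_sinv_mult_left mult_sinv_idempotent(2) by metis

lemma natural_le_mult_left: "u \<preceq> s \<Longrightarrow> r * u \<preceq> r * s"
  unfolding natural_le_def by (auto simp: mult.assoc)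

lemma natural_le_sinv: "u \<preceq> s \<Longrightarrow> sinv u \<preceq> sinv s"
  by (subst natural_le_left) (auto simp: natural_le_def sinv_mult sinv_idempotent)

lemma natural_le_trans: "u \<preceq> s \<Longrightarrow> s \<preceq> t \<Longrightarrow> u \<preceq> t"
  unfolding natural_le_def by (auto simp: mult.assoc intro: idempotents_mult)

text \<open>Two elements below \<open>t\<close> are \<open>t * f\<close> and \<open>t * f'\<close> with commuting idempotents
  \<open>f\<close>, \<open>f'\<close>, so \<open>t * f * f'\<close> is below both; this is what makes \<open>\<sigma>\<close> transitive.\<close>

lemma natural_le_down_directed:
  assumes "u \<preceq> t" "v \<preceq> t"
  shows "\<exists>w. w \<preceq> u \<and> w \<preceq> v"
proof -
  obtain f f' where f: "f \<in> idempotents" "u = t * f" and f': "f' \<in> idempotents" "v = t * f'"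
    using assms by (auto simp: natural_le_def)
  have "u * f' = v * f"
    using f f' by (simp add: mult.assoc idempotents_commute[of f f'])
  then show ?thesis
    using f f' unfolding natural_le_def by metis
qed

lemma min_group_cong_iff: "(s, t) \<in> min_group_cong \<longleftrightarrow> (\<exists>u. u \<preceq> s \<and> u \<preceq> t)"
  by (simp add: min_group_cong_def)

lemma equiv_min_group_cong: "equiv UNIV min_group_cong"
proof (rule equivI)
  show "min_group_cong \<subseteq> UNIV \<times> UNIV" by simp
  show "refl min_group_cong"
    by (auto simp: refl_on_def min_group_cong_iff intro: natural_le_refl)
  show "sym min_group_cong"
    by (auto simp: sym_def min_group_cong_iff)
  show "trans min_group_cong"
    unfolding trans_def min_group_cong_iff
    by (meson natural_le_down_directed natural_le_trans)
qed

lemma min_group_cong_mult_left: "(s, t) \<in> min_group_cong \<Longrightarrow> (r * s, r * t) \<in> min_group_cong"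
  unfolding min_group_cong_iff by (meson natural_le_mult_left)

lemma min_group_cong_sinv: "(s, t) \<in> min_group_cong \<Longrightarrow> (sinv s, sinv t) \<in> min_group_cong"
  unfolding min_group_cong_iff by (meson natural_le_sinv)

lemma min_group_cong_idempotent_left: "e \<in> idempotents \<Longrightarrow> (e * s, s) \<in> min_group_cong"
  unfolding min_group_cong_iff by (meson natural_le_refl natural_le_left)

lemma min_group_cong_idempotent_right: "e \<in> idempotents \<Longrightarrow> (s * e, s) \<in> min_group_cong"
  unfolding min_group_cong_iff by (meson natural_le_refl natural_le_def)

lemma min_group_congD: "g \<in> min_group \<Longrightarrow> s \<in> g \<Longrightarrow> t \<in> g \<Longrightarrow> (s, t) \<in> min_group_cong"
  unfolding min_group_def using quotient_eq_iff[OF equiv_min_group_cong] by metis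

lemma min_group_closed:
  assumes g: "g \<in> min_group" and st: "(s, t) \<in> min_group_cong"
  shows "s \<in> g \<longleftrightarrow> t \<in> g"
proof -
  have "(t, s) \<in> min_group_cong"
    using st by (auto simp: min_group_cong_iff)
  then show ?thesis
    using in_quotient_imp_closed[OF equiv_min_group_cong g[unfolded min_group_def]] st by blast
qed

lemma min_groupI:
  assumes "s \<in> g" "\<And>t. t \<in> g \<longleftrightarrow> (s, t) \<in> min_group_cong"
  shows "g \<in> min_group"
proof -
  have "g = min_group_cong `` {s}"
    using assms by auto
  then show ?thesis
    by (simp add: min_group_def quotientI)
qed

lemma min_group_mult_sinv_left:
  "g \<in> min_group \<Longrightarrow> s * (sinv s * r) \<in> g \<longleftrightarrow> r \<in> g"
  using min_group_closed[OF _ min_group_cong_idempotent_left[of "s * sinv s" r]]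
  by (simp add: mult.assoc)

lemma min_group_mult_sinv_right:
  "g \<in> min_group \<Longrightarrow> r * (s * sinv s) \<in> g \<longleftrightarrow> r \<in> g"
  using min_group_closed[OF _ min_group_cong_idempotent_right[of "s * sinv s" r]]
  by (simp add: mult.assoc)

lemma min_group_nonempty: "g \<in> min_group \<Longrightarrow> \<exists>t. t \<in> g"
  unfolding min_group_def using in_quotient_imp_non_empty[OF equiv_min_group_cong] by blast

text \<open>With \<open>h\<close> the class of \<open>s\<close>, the set \<open>{r. s * r \<in> g}\<close> is the product \<open>h\<inverse>g\<close> in the group of
  \<open>\<sigma>\<close>-classes. Writing translations as preimages avoids choosing representatives.\<close>

lemma min_group_vimage_left:
  assumes g: "g \<in> min_group"
  shows "{r. s * r \<in> g} \<in> min_group"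
proof -
  obtain t where t: "t \<in> g"
    using min_group_nonempty[OF g] by blast
  show ?thesis
  proof (rule min_groupI)
    show mem: "sinv s * t \<in> {r. s * r \<in> g}"
      using t by (simp add: min_group_mult_sinv_left[OF g])
    fix r
    show "r \<in> {r. s * r \<in> g} \<longleftrightarrow> (sinv s * t, r) \<in> min_group_cong"
    proof
      assume "r \<in> {r. s * r \<in> g}"
      then have "(t, s * r) \<in> min_group_cong"
        using min_group_congD[OF g t] by simp
      then have "(sinv s * t, sinv s * s * r) \<in> min_group_cong"
        using min_group_cong_mult_left[of t _ "sinv s"] by (simp add: mult.assoc)
      moreover have "(sinv s * s * r, r) \<in> min_group_cong"
        by (rule min_group_cong_idempotent_left) simp
      ultimately show "(sinv s * t, r) \<in> min_group_cong"
        using equiv_min_group_cong by (meson equivE transD)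
    next
      assume "(sinv s * t, r) \<in> min_group_cong"
      then show "r \<in> {r. s * r \<in> g}"
        using min_group_closed[OF g min_group_cong_mult_left[of "sinv s * t" r s]] mem by simp
    qed
  qed
qed

text \<open>Inversion is an anti-automorphism that preserves \<open>\<sigma>\<close>, so it permutes the
  \<open>\<sigma>\<close>-classes, exchanging left and right translation.\<close>

lemma min_group_vimage_sinv:
  assumes g: "g \<in> min_group"
  shows "sinv -` g \<in> min_group"
proof -
  obtain t where t: "t \<in> g"
    using min_group_nonempty[OF g] by blast
  show ?thesis
  proof (rule min_groupI)
    show "sinv t \<in> sinv -` g" using t by simp
    fix r
    have "(sinv t, r) \<in> min_group_cong \<longleftrightarrow> (t, sinv r) \<in> min_group_cong"
      using min_group_cong_sinv[of t "sinv r"] min_group_cong_sinv[of "sinv t" r] by auto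
    also have "\<dots> \<longleftrightarrow> sinv r \<in> g"
      using min_group_congD[OF g t] min_group_closed[OF g] t by blast
    finally show "r \<in> sinv -` g \<longleftrightarrow> (sinv t, r) \<in> min_group_cong"
      by simp
  qed
qed

lemma min_group_vimage_right:
  assumes g: "g \<in> min_group"
  shows "{r. r * s \<in> g} \<in> min_group"
proof -
  have "sinv -` {r. sinv s * r \<in> sinv -` g} \<in> min_group"
    by (intro min_group_vimage_sinv min_group_vimage_left g)
  also have "sinv -` {r. sinv s * r \<in> sinv -` g} = {r. r * s \<in> g}"
    by (auto simp: sinv_mult)
  finally show ?thesis .
qed

lemma bij_betw_min_group_left: "bij_betw (\<lambda>g. {r. s * r \<in> g}) min_group min_group"
  by (rule bij_betw_byWitness[where f' = "\<lambda>g. {r. sinv s * r \<in> g}"])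
     (use min_group_mult_sinv_left[of _ "sinv s"] in
       \<open>auto simp: min_group_mult_sinv_left min_group_vimage_left\<close>)

lemma bij_betw_min_group_right: "bij_betw (\<lambda>g. {r. r * s \<in> g}) min_group min_group"
  by (rule bij_betw_byWitness[where f' = "\<lambda>g. {r. r * sinv s \<in> g}"])
     (use min_group_mult_sinv_right[of _ _ "sinv s"] in
       \<open>auto simp: min_group_mult_sinv_right min_group_vimage_right mult.assoc\<close>)

lemma class_inv_eq:
  assumes g: "g \<in> min_group"
  shows "class_inv g = sinv ` g"
proof (intro equalityI subsetI)
  fix r assume "r \<in> class_inv g"
  then obtain s where "s \<in> g" "(sinv s, r) \<in> min_group_cong"
    by (auto simp: class_inv_def)
  then have "sinv r \<in> g"
    using min_group_cong_sinv[of "sinv s" r] min_group_closed[OF g, of s "sinv r"] by simp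
  then show "r \<in> sinv ` g"
    by (metis image_eqI sinv_sinv)
next
  fix r assume "r \<in> sinv ` g"
  then show "r \<in> class_inv g"
    using equiv_min_group_cong by (auto simp: class_inv_def equiv_def refl_on_def)
qed

end

context e_unitary_inverse_semigroup
begin

text \<open>If \<open>u\<close> is below both \<open>s\<close> and \<open>t\<close>, then the idempotent \<open>u * sinv u\<close> is below
  \<open>s * sinv t\<close>, and being \<open>E\<close>-unitary applies.\<close>

lemma min_group_cong_mult_sinv_idempotent:
  assumes "(s, t) \<in> min_group_cong"
  shows "s * sinv t \<in> idempotents"
proof -
  obtain u f f' where f: "f \<in> idempotents" "u = s * f" and f': "f' \<in> idempotents" "u = t * f'"
    using assms by (auto simp: min_group_cong_iff natural_le_def)
  have "u * sinv u = s * (f * f') * sinv t"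
    by (subst f(2), subst f'(2)) (simp add: sinv_mult sinv_idempotent f' mult.assoc)
  then have "u * sinv u \<preceq> s * sinv t"
    unfolding natural_le_left
    using mult_idempotent_eq[of "f * f'" s] conj_idempotent[of "f * f'" s]
      idempotents_mult[OF f(1) f'(1)] by (metis mult.assoc)
  then show ?thesis
    using e_unitary mult_sinv_idempotent(1) by blast
qed

text \<open>For \<open>\<sigma>\<close>-related \<open>s\<close> and \<open>t\<close>, restricting \<open>t\<close> to the range of \<open>s\<close> and restricting
  \<open>s\<close> to the domain of \<open>t\<close> both give the meet of \<open>s\<close> and \<open>t\<close>.\<close>

lemma min_group_cong_meet:
  assumes "(s, t) \<in> min_group_cong"
  shows "s * (sinv s * t) = s * (sinv t * t)"
proof -
  have e: "s * sinv t \<in> idempotents"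
    using assms by (rule min_group_cong_mult_sinv_idempotent)
  have f: "sinv s * t \<in> idempotents"
    using min_group_cong_mult_sinv_idempotent[OF min_group_cong_sinv[OF assms]] by simp
  have ts: "s * sinv t = t * sinv s" and st: "sinv s * t = sinv t * s"
    using sinv_idempotent[OF e] sinv_idempotent[OF f] by (simp_all add: sinv_mult)
  have "s * (sinv s * t) = s * (sinv t * s)"
    by (simp only: st)
  also have "\<dots> = (s * sinv t) * ((s * sinv t) * s)"
    using idempotents_absorb[OF e, of s] by (simp add: mult.assoc)
  also have "\<dots> = (s * sinv t) * ((t * sinv s) * s)"
    by (simp only: ts)
  also have "\<dots> = s * ((sinv t * t) * (sinv s * s))"
    by (simp add: mult.assoc)
  also have "(sinv t * t) * (sinv s * s) = (sinv s * s) * (sinv t * t)"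
    by (rule idempotents_commute) simp_all
  finally show ?thesis
    by (simp add: mult.assoc)
qed

end


section \<open>Unital actions\<close>

locale unital_inverse_semigroup_action = inverse_semigroup_action scale A \<beta>
  for scale :: "'k::comm_ring_1 \<Rightarrow> 'a::ring \<Rightarrow> 'a"
    and A :: "'s::inverse_semigroup \<Rightarrow> 'a set"
    and \<beta> :: "'s \<Rightarrow> 'a \<Rightarrow> 'a" +
  assumes unital: "unital_action scale A"
begin

abbreviation one :: "'s \<Rightarrow> 'a" where
  "one s \<equiv> generating_idempotent scale (A s)"

lemma generates_ideal_iff:
  assumes e: "central_idempotent e"
  shows "generates_ideal scale e (A s) \<longleftrightarrow> A s = {a. e * a = a}"
proof -
  let ?I = "{a. e * a = a}"
  have idem: "e * e = e" and comm: "e * a = a * e" for a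
    using e unfolding central_idempotent_def by blast+
  have I: "two_sided_ideal scale ?I"
    unfolding two_sided_ideal_def
  proof (intro conjI ballI allI)
    show "subspace ?I"
      by (rule subspaceI) (simp_all add: distrib_left scale_mult_right[symmetric])
    fix x a assume "x \<in> ?I"
    then have x: "e * x = x" by simp
    have "e * (a * x) = a * (e * x)"
      by (simp only: mult.assoc[symmetric] comm[of a])
    moreover have "e * (x * a) = (e * x) * a"
      by (simp add: mult.assoc)
    ultimately show "a * x \<in> ?I" "x * a \<in> ?I"
      by (simp_all add: x)
  qed
  have min: "?I \<subseteq> J" if J: "two_sided_ideal scale J" "{e} \<subseteq> J" for J
  proof
    fix a assume "a \<in> ?I"
    then have "a = e * a" by simp
    also have "\<dots> \<in> J"
      using J unfolding two_sided_ideal_def by blast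
    finally show "a \<in> J" .
  qed
  have "{e} \<subseteq> ?I"
    using idem by simp
  then have "two_sided_ideal scale hull {e} = ?I"
    using I min by (rule hull_unique)
  then show ?thesis
    by (simp add: generates_ideal_def)
qed

text \<open>Two central idempotents generating the same ideal are both identity elements of it, so the
  definite description is proper; its value then decides membership in the ideal by a single
  equation.\<close>

lemma one_props: "central_idempotent (one s)" "A s = {a. one s * a = a}"
proof -
  have "\<exists>!e. central_idempotent e \<and> generates_ideal scale e (A s)"
  proof (rule ex_ex1I)
    show "\<exists>e. central_idempotent e \<and> generates_ideal scale e (A s)"
      using unital by (simp add: unital_action_def)
    fix e f
    assume e: "central_idempotent e \<and> generates_ideal scale e (A s)"
      and f: "central_idempotent f \<and> generates_ideal scale f (A s)"
    have A: "A s = {a. e * a = a}" "A s = {a. f * a = a}"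
      using e f generates_ideal_iff by blast+
    have "f \<in> A s" "e \<in> A s"
      using e f unfolding central_idempotent_def by (subst A(2), blast, subst A(1), blast)
    then have "e * f = f" "f * e = e"
      using A by blast+
    then show "e = f"
      using e unfolding central_idempotent_def by metis
  qed
  from theI'[OF this] show "central_idempotent (one s)" "A s = {a. one s * a = a}"
    unfolding generating_idempotent_def[symmetric] using generates_ideal_iff by blast+
qed

lemma one_idem [simp]: "one s * one s = one s"
  and one_commute: "a * one s = one s * a"
  using one_props(1)[of s] unfolding central_idempotent_def by metis+

lemma one_absorb [simp]: "one s * (one s * a) = one s * a"
  by (simp add: mult.assoc[symmetric])

lemma one_left_commute: "a * (one s * b) = one s * (a * b)"
  by (metis mult.assoc one_commute)

lemma mem_iff: "a \<in> A s \<longleftrightarrow> one s * a = a"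
  using one_props(2) by auto

lemma mem_mult_one [simp]: "one s * a \<in> A s" "one s \<in> A s"
  by (simp_all add: mem_iff)

lemma zero_mem [simp]: "0 \<in> A s"
  and add_mem: "a \<in> A s \<Longrightarrow> b \<in> A s \<Longrightarrow> a + b \<in> A s"
  by (simp_all add: mem_iff distrib_left)

lemma mult_mem_left: "a \<in> A s \<Longrightarrow> b * a \<in> A s"
  by (metis mem_iff one_left_commute)

lemma mult_mem_right: "a \<in> A s \<Longrightarrow> a * b \<in> A s"
  by (metis mem_iff mult.assoc)

text \<open>The extension of \<open>\<beta> s\<close> by zero on the annihilator of \<open>one (sinv s)\<close>; its values are
  meaningful everywhere, unlike those of \<open>\<beta> s\<close>.\<close>

definition ext_map :: "'s \<Rightarrow> 'a \<Rightarrow> 'a" where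
  "ext_map s a = \<beta> s (one (sinv s) * a)"

lemma map_mem: "a \<in> A (sinv s) \<Longrightarrow> \<beta> s a \<in> A s"
  using bij bij_betw_apply by metis

lemma ext_eq: "a \<in> A (sinv s) \<Longrightarrow> ext_map s a = \<beta> s a"
  by (simp add: ext_map_def mem_iff)

lemma ext_mem: "ext_map s a \<in> A s"
  by (simp add: ext_map_def map_mem)

lemma ext_add: "ext_map s (a + b) = ext_map s a + ext_map s b"
  by (simp add: ext_map_def distrib_left map_add)

lemma ext_mult: "ext_map s (a * b) = ext_map s a * ext_map s b"
proof -
  have "one (sinv s) * (a * b) = (one (sinv s) * a) * (one (sinv s) * b)"
    by (metis mult.assoc one_absorb one_left_commute)
  then show ?thesis
    by (simp add: ext_map_def map_mult)
qed

lemma ext_zero [simp]: "ext_map s 0 = 0"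
  using ext_add[of s 0 0] by simp

lemma ext_sum: "ext_map s (sum x F) = (\<Sum>i\<in>F. ext_map s (x i))"
  by (induction F rule: infinite_finite_induct) (simp_all add: ext_add)

text \<open>On \<open>A e\<close> the map \<open>\<beta> e\<close> is an idempotent bijection.\<close>

lemma map_idempotent:
  assumes e: "e \<in> idempotents" and a: "a \<in> A e"
  shows "\<beta> e a = a"
proof -
  have inv: "sinv e = e" and ee: "e * e = e"
    using e by (simp_all add: sinv_idempotent idempotentsD)
  have "\<beta> e (\<beta> e a) = \<beta> e a"
    using map_comp[of a e e] a by (simp add: inv ee)
  moreover have "inj_on (\<beta> e) (A e)" "\<beta> e a \<in> A e"
    using bij[of e] map_mem[of a e] a by (simp_all add: inv bij_betw_def)
  ultimately show ?thesis
    using a by (auto dest: inj_onD)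
qed

lemma ext_idempotent: "e \<in> idempotents \<Longrightarrow> ext_map e a = one e * a"
  by (simp add: ext_map_def sinv_idempotent map_idempotent)

text \<open>The map \<open>\<beta> t\<close> carries the ideal \<open>A (sinv (s * t))\<close> onto \<open>A t \<inter> A (sinv s)\<close>, so it carries
  the identity element of the first to that of the second.\<close>

lemma map_one_sinv_mult: "\<beta> t (one (sinv (s * t))) = one t * one (sinv s)"
proof -
  let ?p = "one (sinv (s * t))"
  have p: "?p \<in> A (sinv t)" "\<beta> t ?p \<in> A t" "\<beta> t ?p \<in> A (sinv s)"
    using domain_mult[of s t] mem_mult_one(2)[of "sinv (s * t)"] by auto
  have "one t * one (sinv s) \<in> A t"
    by simp
  then obtain q where q: "q \<in> A (sinv t)" "\<beta> t q = one t * one (sinv s)"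
    using bij[of t] by (metis bij_betw_def imageE)
  have "\<beta> t q \<in> A (sinv s)"
    unfolding q(2) by (simp add: mult_mem_left)
  then have "q \<in> A (sinv (s * t))"
    unfolding domain_mult[of s t] using q(1) map_mem by blast
  then have "\<beta> t q = \<beta> t (?p * q)"
    by (simp add: mem_iff)
  also have "\<dots> = \<beta> t ?p * (one t * one (sinv s))"
    by (simp add: map_mult p q)
  also have "\<dots> = one (sinv s) * (one t * \<beta> t ?p)"
    by (metis mult.assoc one_commute)
  also have "\<dots> = \<beta> t ?p"
    using p by (simp add: mem_iff)
  finally show ?thesis
    using q(2) by simp
qed

text \<open>Inserting \<open>one (sinv s) * one t = \<beta> t (one (sinv (s * t)))\<close> between the two maps moves the
  argument into the domain on which \<open>\<beta> s\<close> and \<open>\<beta> t\<close> are known to compose.\<close>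

lemma ext_comp: "ext_map s (ext_map t a) = ext_map (s * t) a"
proof -
  let ?p = "one (sinv (s * t))"
  have p: "?p \<in> A (sinv t)"
    using domain_mult[of s t] mem_mult_one(2)[of "sinv (s * t)"] by auto
  have "ext_map s (ext_map t a) = \<beta> s (one (sinv s) * (one t * ext_map t a))"
    using ext_mem[of t a] by (simp add: ext_map_def[of s] mem_iff)
  also have "one (sinv s) * (one t * ext_map t a) = \<beta> t ?p * ext_map t a"
    unfolding map_one_sinv_mult by (metis mult.assoc one_commute)
  also have "\<dots> = ext_map t (?p * a)"
    by (simp add: ext_mult ext_eq[OF p])
  also have "\<dots> = \<beta> t (?p * a)"
    by (simp add: ext_eq mult_mem_right p)
  also have "\<beta> s \<dots> = ext_map (s * t) a"
    by (simp add: ext_map_def map_comp)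
  finally show ?thesis .
qed

lemma mult_sinv_ideal: "A (s * sinv s) = A s"
  using domain_mult[of s "sinv s"] map_mem[of _ "sinv s"]
  by (auto simp: sinv_mult)

text \<open>Multiplication by \<open>one s\<close> is itself an extended map, so that products of such
  multiplications with extended maps are computed in the semigroup.\<close>

lemma one_mult_eq_ext: "one s * a = ext_map (s * sinv s) a"
  by (simp add: ext_idempotent mult_sinv_ideal)

lemma one_mult_ext: "one r * ext_map t a = ext_map (r * (sinv r * t)) a"
  by (simp add: one_mult_eq_ext ext_comp mult.assoc)

lemma ext_one_mult: "ext_map t (one r * a) = ext_map (t * (r * sinv r)) a"
  by (simp add: one_mult_eq_ext ext_comp)

lemma one_mult_one: "one r * (one t * a) = one (r * (sinv r * t)) * a"
proof -
  have c: "sinv r * (t * sinv t) = sinv r * (t * sinv t) * (r * sinv r)"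
  proof -
    have "sinv r * (t * sinv t) = sinv r * ((r * sinv r) * (t * sinv t))"
      by (simp add: mult.assoc)
    also have "(r * sinv r) * (t * sinv t) = (t * sinv t) * (r * sinv r)"
      by (rule idempotents_commute) simp_all
    finally show ?thesis
      by (simp add: mult.assoc)
  qed
  show ?thesis
    unfolding one_mult_eq_ext[of t] one_mult_eq_ext[of "r * (sinv r * t)"] one_mult_ext
    using c by (simp add: sinv_mult mult.assoc)
qed

text \<open>The identity element can be pulled back along \<open>s\<close>, because
  \<open>(s * t) * sinv (s * t) * s = s * (t * sinv t)\<close>.\<close>

lemma ext_mult_one: "one (s * t) * ext_map s a = ext_map s (one t * a)"
proof -
  have c: "sinv s * (s * (t * sinv t)) = t * (sinv t * (sinv s * s))"
    using idempotents_commute[of "sinv s * s" "t * sinv t"] by (simp add: mult.assoc)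
  have "one (s * t) * ext_map s a = ext_map (s * (t * (sinv t * (sinv s * s)))) a"
    by (simp add: one_mult_ext sinv_mult mult.assoc)
  also have "\<dots> = ext_map s (one t * a)"
    unfolding c[symmetric] by (simp add: ext_one_mult)
  finally show ?thesis .
qed

lemma invariants_iff: "a \<in> invariants scale A \<beta> \<longleftrightarrow> (\<forall>s. ext_map s a = one s * a)"
  by (simp add: invariants_def ext_map_def one_commute)

text \<open>Multiplicativity gives \<open>ext_map s (r * a) = one s * r * ext_map s a\<close>, and \<open>one s\<close> is absorbed
  by the last factor.\<close>

lemma ext_invariant_mult:
  assumes "r \<in> invariants scale A \<beta>"
  shows "ext_map s (r * a) = r * ext_map s a" "ext_map s (a * r) = ext_map s a * r"
proof -
  have "one s * ext_map s a = ext_map s a"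
    using ext_mem mem_iff by blast
  moreover have "ext_map s r = one s * r" "one s * r = r * one s"
    using assms by (simp_all add: invariants_iff one_commute)
  ultimately show "ext_map s (r * a) = r * ext_map s a" "ext_map s (a * r) = ext_map s a * r"
    by (metis ext_mult mult.assoc, metis ext_mult mult.assoc one_commute)
qed

end


section \<open>Sums of ideals\<close>

context unital_inverse_semigroup_action
begin

lemma ideal_sumI:
  assumes "finite F" "F \<subseteq> T" "\<And>t. t \<in> F \<Longrightarrow> x t \<in> A t"
  shows "sum x F \<in> ideal_sum A T"
  unfolding ideal_sum_def using assms by (intro CollectI exI[of _ F] exI[of _ x]) simp

text \<open>Extending a family by zero makes it range over all of \<open>T\<close>, so that two elements of the sum
  can be compared over one index set.\<close>

lemma ideal_sum_family:
  assumes "finite T" "b \<in> ideal_sum A T"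
  shows "\<exists>x. (\<forall>t\<in>T. x t \<in> A t) \<and> b = sum x T"
proof -
  obtain F x where F: "finite F" "F \<subseteq> T" "\<forall>t\<in>F. x t \<in> A t" "b = sum x F"
    using assms(2) by (auto simp: ideal_sum_def)
  let ?y = "\<lambda>t. if t \<in> F then x t else 0"
  have "b = sum ?y T"
    using F assms(1) by (simp add: sum.If_cases Int_absorb1)
  moreover have "\<forall>t\<in>T. ?y t \<in> A t"
    using F(3) by simp
  ultimately show ?thesis
    by (intro exI[of _ ?y]) simp
qed

lemma ideal_sum_member: "t \<in> T \<Longrightarrow> a \<in> A t \<Longrightarrow> a \<in> ideal_sum A T"
  using ideal_sumI[of "{t}" T "\<lambda>_. a"] by simp

lemma ext_ideal_sum: "t \<in> T \<Longrightarrow> ext_map t a \<in> ideal_sum A T"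
  by (rule ideal_sum_member[OF _ ext_mem])

lemma ideal_sum_zero: "0 \<in> ideal_sum A T"
  using ideal_sumI[of "{}" T] by simp

lemma ideal_sum_add:
  assumes "finite T" "a \<in> ideal_sum A T" "b \<in> ideal_sum A T"
  shows "a + b \<in> ideal_sum A T"
proof -
  obtain x where x: "\<And>t. t \<in> T \<Longrightarrow> x t \<in> A t" "a = sum x T"
    using ideal_sum_family[OF assms(1,2)] by blast
  obtain y where y: "\<And>t. t \<in> T \<Longrightarrow> y t \<in> A t" "b = sum y T"
    using ideal_sum_family[OF assms(1,3)] by blast
  have "(\<Sum>t\<in>T. x t + y t) \<in> ideal_sum A T"
    using assms(1) x y by (intro ideal_sumI add_mem) simp_all
  then show ?thesis
    by (simp add: x y sum.distrib)
qed

lemma ideal_sum_sum: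
  assumes "finite T" "\<And>i. i \<in> I \<Longrightarrow> x i \<in> ideal_sum A T"
  shows "sum x I \<in> ideal_sum A T"
  using assms(2)
  by (induction I rule: infinite_finite_induct)
    (simp_all add: ideal_sum_zero ideal_sum_add assms(1))

lemma ideal_sum_mult:
  assumes "finite T" "b \<in> ideal_sum A T"
  shows "a * b \<in> ideal_sum A T" "b * a \<in> ideal_sum A T"
proof -
  obtain x where x: "\<And>t. t \<in> T \<Longrightarrow> x t \<in> A t" "b = sum x T"
    using ideal_sum_family[OF assms] by blast
  show "a * b \<in> ideal_sum A T" "b * a \<in> ideal_sum A T"
    unfolding x(2) sum_distrib_left sum_distrib_right
    using assms(1) x(1) by (simp_all add: ideal_sumI mult_mem_left mult_mem_right)
qed

lemma ideal_sum_mono: "T \<subseteq> T' \<Longrightarrow> ideal_sum A T \<subseteq> ideal_sum A T'"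
  unfolding ideal_sum_def by blast

text \<open>The identity element is the join of the central idempotents \<open>one t\<close>, built up by
  \<open>d = one u + e - e * one u\<close>. As a combination of the \<open>one t\<close> it annihilates every element that all
  of them annihilate.\<close>

lemma ideal_sum_has_identity:
  assumes "finite T"
  shows "\<exists>e\<in>ideal_sum A T. (\<forall>a. a * e = e * a) \<and> (\<forall>t\<in>T. e * one t = one t) \<and>
    (\<forall>a. (\<forall>t\<in>T. one t * a = 0) \<longrightarrow> e * a = 0)"
  using assms
proof (induction T)
  case empty
  then show ?case
    by (auto intro!: bexI[of _ 0] ideal_sum_zero)
next
  case (insert u T)
  then obtain e where e: "e \<in> ideal_sum A T" "\<And>a. a * e = e * a"
    "\<And>t. t \<in> T \<Longrightarrow> e * one t = one t"
    "\<And>a. (\<forall>t\<in>T. one t * a = 0) \<Longrightarrow> e * a = 0"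
    by blast
  define d where "d = (one u - e * one u) + e"
  have "one u - e * one u \<in> A u"
    by (simp add: mem_iff right_diff_distrib one_left_commute[symmetric])
  then have "d \<in> ideal_sum A (insert u T)"
    unfolding d_def using insert.hyps e(1) ideal_sum_mono[of T "insert u T"]
    by (intro ideal_sum_add) (auto intro: ideal_sum_member)
  moreover have "a * d = d * a" for a
  proof -
    have "a * (e * one u) = e * one u * a"
      by (metis e(2) mult.assoc one_commute)
    then show ?thesis
      by (simp add: d_def distrib_left distrib_right left_diff_distrib right_diff_distrib
          e(2)[of a] one_commute[of a])
  qed
  moreover have "d * one t = one t" if "t \<in> insert u T" for t
  proof (cases "t = u")
    case True
    then show ?thesis
      by (simp add: d_def distrib_right left_diff_distrib mult.assoc)
  next
    case False
    then have "e * one t = one t"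
      using that e(3) by simp
    moreover from this have "e * one u * one t = one u * one t"
      by (metis mult.assoc one_commute)
    ultimately show ?thesis
      by (simp add: d_def distrib_right left_diff_distrib)
  qed
  moreover have "d * a = 0" if "\<forall>t\<in>insert u T. one t * a = 0" for a
    using that e(4)[of a] by (simp add: d_def distrib_right left_diff_distrib mult.assoc)
  ultimately show ?case
    by blast
qed

lemma ideal_sum_identity:
  assumes "finite T"
  defines "e \<equiv> identity_of (ideal_sum A T)"
  shows "e \<in> ideal_sum A T" "\<And>a. a * e = e * a" "\<And>t. t \<in> T \<Longrightarrow> e * one t = one t"
    "\<And>b. b \<in> ideal_sum A T \<Longrightarrow> e * b = b"
    "\<And>a. (\<And>t. t \<in> T \<Longrightarrow> one t * a = 0) \<Longrightarrow> e * a = 0"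
proof -
  obtain d where d: "d \<in> ideal_sum A T" "\<And>a. a * d = d * a"
    "\<And>t. t \<in> T \<Longrightarrow> d * one t = one t"
    "\<And>a. (\<And>t. t \<in> T \<Longrightarrow> one t * a = 0) \<Longrightarrow> d * a = 0"
    using ideal_sum_has_identity[OF assms(1)] by metis
  have id: "d * b = b" if "b \<in> ideal_sum A T" for b
  proof -
    obtain x where x: "\<And>t. t \<in> T \<Longrightarrow> x t \<in> A t" "b = sum x T"
      using ideal_sum_family[OF assms(1) \<open>b \<in> ideal_sum A T\<close>] by blast
    have "d * x t = x t" if "t \<in> T" for t
      using d(3)[OF that] x(1)[OF that] by (metis mem_iff mult.assoc)
    then show ?thesis
      by (simp add: x(2) sum_distrib_left)
  qed
  have "e = d"
    unfolding e_def identity_of_def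
  proof (rule the_equality)
    show "d \<in> ideal_sum A T \<and> (\<forall>x\<in>ideal_sum A T. d * x = x \<and> x * d = x)"
      using d(1,2) id by simp
    show "c = d" if "c \<in> ideal_sum A T \<and> (\<forall>x\<in>ideal_sum A T. c * x = x \<and> x * c = x)" for c
      using that d(1) id by metis
  qed
  with d id show "e \<in> ideal_sum A T" "\<And>a. a * e = e * a" "\<And>t. t \<in> T \<Longrightarrow> e * one t = one t"
    "\<And>b. b \<in> ideal_sum A T \<Longrightarrow> e * b = b"
    "\<And>a. (\<And>t. t \<in> T \<Longrightarrow> one t * a = 0) \<Longrightarrow> e * a = 0"
    by auto
qed

text \<open>The difference \<open>b - c\<close> is annihilated by all \<open>one t\<close>, hence by the identity element of the
  sum, which fixes it.\<close>

lemma ideal_sum_eqI: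
  assumes "finite T" "b \<in> ideal_sum A T" "c \<in> ideal_sum A T"
    and eq: "\<And>t. t \<in> T \<Longrightarrow> one t * b = one t * c"
  shows "b = c"
proof -
  have "identity_of (ideal_sum A T) * (b - c) = 0"
    by (rule ideal_sum_identity(5)[OF assms(1)]) (simp add: right_diff_distrib eq)
  then show ?thesis
    using assms(2,3) ideal_sum_identity(4)[OF assms(1)] by (simp add: right_diff_distrib)
qed

end


section \<open>The induced partial action and its trace\<close>

locale finite_e_unitary_action = unital_inverse_semigroup_action scale A \<beta>
  for scale :: "'k::comm_ring_1 \<Rightarrow> 'a::ring \<Rightarrow> 'a"
    and A :: "'s::{e_unitary_inverse_semigroup, finite} \<Rightarrow> 'a set"
    and \<beta> :: "'s \<Rightarrow> 'a \<Rightarrow> 'a"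
begin

text \<open>The maps \<open>\<beta> r\<close> and \<open>\<beta> t\<close> of \<open>\<sigma>\<close>-related elements agree on the intersection of their
  domains, and that intersection is mapped onto the intersection of their ranges.\<close>

lemma one_mult_ext_cong:
  assumes "(r, t) \<in> min_group_cong"
  shows "one r * ext_map t a = ext_map r (one (sinv t) * a)"
  by (simp add: one_mult_ext ext_one_mult min_group_cong_meet[OF assms])

text \<open>The products of the glued sum with the \<open>one r\<close> depend only on the sum of the \<open>x i\<close>. This is
  the reason why the induced map is well defined. The index set is arbitrary because one family of
  arguments is later used over two different classes.\<close>

lemma one_mult_sum_ext:
  assumes "g \<in> min_group" "r \<in> g"
    and "\<And>i. i \<in> I \<Longrightarrow> u i \<in> g" "\<And>i. i \<in> I \<Longrightarrow> x i \<in> A (sinv (u i))"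
  shows "one r * (\<Sum>i\<in>I. ext_map (u i) (x i)) = ext_map r (sum x I)"
  unfolding sum_distrib_left ext_sum
proof (rule sum.cong)
  fix i assume i: "i \<in> I"
  show "one r * ext_map (u i) (x i) = ext_map r (x i)"
    using one_mult_ext_cong[OF min_group_congD[OF assms(1,2) assms(3)[OF i]]] assms(4)[OF i]
    by (simp add: mem_iff)
qed simp

text \<open>The unit \<open>1\<^bsub>g\<inverse>\<^esub>\<close> of the domain of the induced map of the class \<open>g\<close>.\<close>

definition dom_one :: "'s set \<Rightarrow> 'a" where
  "dom_one g = identity_of (induced_ideal A (class_inv g))"

text \<open>The summand of the trace at the class \<open>g\<close>; it is to the induced map of \<open>g\<close> what \<open>ext_map s\<close>
  is to \<open>\<beta> s\<close>.\<close>

definition class_ext :: "'s set \<Rightarrow> 'a \<Rightarrow> 'a" where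
  "class_ext g a = induced_map A \<beta> g (a * dom_one g)"

lemma sigma_trace_eq: "sigma_trace A \<beta> a = (\<Sum>g\<in>min_group. class_ext g a)"
  by (simp add: sigma_trace_def class_ext_def dom_one_def)

lemma dom_one_eq: "g \<in> min_group \<Longrightarrow> dom_one g = identity_of (ideal_sum A (sinv ` g))"
  by (simp add: dom_one_def induced_ideal_def class_inv_eq)

lemma ext_dom_one:
  assumes "g \<in> min_group" "r \<in> g"
  shows "ext_map r (a * dom_one g) = ext_map r a"
proof -
  have "dom_one g * one (sinv r) = one (sinv r)"
    unfolding dom_one_eq[OF assms(1)] by (rule ideal_sum_identity(3)) (use assms(2) in simp_all)
  then have "one (sinv r) * (a * dom_one g) = one (sinv r) * a"
    by (metis mult.assoc one_commute)
  then show ?thesis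
    by (simp add: ext_map_def)
qed

text \<open>All candidates for the value of the induced map lie in \<open>ideal_sum A g\<close> and have the same
  products with each \<open>one r\<close>, so they coincide.\<close>

lemma class_ext_family:
  assumes g: "g \<in> min_group"
  shows "\<exists>x. (\<forall>t\<in>g. x t \<in> A (sinv t)) \<and> a * dom_one g = sum x g \<and>
    class_ext g a = (\<Sum>t\<in>g. ext_map t (x t))"
proof -
  have "a * dom_one g \<in> ideal_sum A (sinv ` g)"
    unfolding dom_one_eq[OF g] by (intro ideal_sum_mult ideal_sum_identity(1)) simp_all
  from ideal_sum_family[OF _ this]
  obtain y where y: "\<forall>t\<in>sinv ` g. y t \<in> A t" "a * dom_one g = sum y (sinv ` g)"
    by auto
  have inj: "inj_on sinv g"
    by (metis inj_onI sinv_sinv)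
  define x where "x t = y (sinv t)" for t
  have x: "\<forall>t\<in>g. x t \<in> A (sinv t)" and a: "a * dom_one g = sum x g"
    using y by (simp_all add: x_def sum.reindex[OF inj])
  let ?b = "\<Sum>t\<in>g. \<beta> t (x t)"
  have "class_ext g a = ?b"
    unfolding class_ext_def induced_map_def
  proof (rule the_equality)
    show "\<exists>F x. finite F \<and> F \<subseteq> g \<and> (\<forall>t\<in>F. x t \<in> A (sinv t)) \<and>
        a * dom_one g = (\<Sum>t\<in>F. x t) \<and> ?b = (\<Sum>t\<in>F. \<beta> t (x t))"
      using x a by (intro exI[of _ g] exI[of _ x]) simp
    fix c
    assume "\<exists>F x. finite F \<and> F \<subseteq> g \<and> (\<forall>t\<in>F. x t \<in> A (sinv t)) \<and>
        a * dom_one g = (\<Sum>t\<in>F. x t) \<and> c = (\<Sum>t\<in>F. \<beta> t (x t))"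
    then obtain F z where F: "F \<subseteq> g" "\<forall>t\<in>F. z t \<in> A (sinv t)"
      "a * dom_one g = sum z F" "c = (\<Sum>t\<in>F. \<beta> t (z t))"
      by blast
    have b: "?b = (\<Sum>t\<in>g. ext_map t (x t))" and c: "c = (\<Sum>t\<in>F. ext_map t (z t))"
      using F x by (simp_all add: ext_eq)
    show "c = ?b"
    proof (rule ideal_sum_eqI)
      show "c \<in> ideal_sum A g" "?b \<in> ideal_sum A g"
        unfolding b c using F(1) by (auto intro!: ideal_sumI ext_mem)
      fix r assume r: "r \<in> g"
      have "one r * c = ext_map r (sum z F)"
        unfolding c using F by (intro one_mult_sum_ext[OF g r]) auto
      moreover have "one r * ?b = ext_map r (sum x g)"
        unfolding b using x by (intro one_mult_sum_ext[OF g r]) auto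
      ultimately show "one r * c = one r * ?b"
        using F(3) a by simp
    qed simp
  qed
  also have "\<dots> = (\<Sum>t\<in>g. ext_map t (x t))"
    using x by (simp add: ext_eq)
  finally show ?thesis
    using x a by blast
qed

lemma class_ext_mem:
  assumes "g \<in> min_group"
  shows "class_ext g a \<in> ideal_sum A g"
proof -
  obtain x where "class_ext g a = (\<Sum>t\<in>g. ext_map t (x t))"
    using class_ext_family[OF assms] by blast
  then show ?thesis
    by (simp add: ideal_sumI ext_mem)
qed

lemma one_mult_class_ext:
  assumes "g \<in> min_group" "r \<in> g"
  shows "one r * class_ext g a = ext_map r a"
proof -
  obtain x where x: "\<forall>t\<in>g. x t \<in> A (sinv t)" "a * dom_one g = sum x g"
    "class_ext g a = (\<Sum>t\<in>g. ext_map t (x t))"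
    using class_ext_family[OF assms(1)] by blast
  have "one r * class_ext g a = ext_map r (sum x g)"
    unfolding x(3) using x(1) by (intro one_mult_sum_ext[OF assms]) auto
  then show ?thesis
    by (simp add: x(2)[symmetric] ext_dom_one assms)
qed

text \<open>Together with the two preceding lemmas this is the characterisation on which the remaining
  proofs rest.\<close>

lemma class_ext_eqI:
  assumes "g \<in> min_group" "b \<in> ideal_sum A g" "\<And>r. r \<in> g \<Longrightarrow> one r * b = ext_map r a"
  shows "class_ext g a = b"
  by (rule ideal_sum_eqI[of g]) (simp_all add: assms class_ext_mem one_mult_class_ext)

lemma class_ext_add:
  assumes g: "g \<in> min_group"
  shows "class_ext g (a + b) = class_ext g a + class_ext g b"
  by (rule class_ext_eqI[OF g])
    (simp_all add: ideal_sum_add class_ext_mem g distrib_left one_mult_class_ext ext_add)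

lemma class_ext_invariant_mult:
  assumes g: "g \<in> min_group" and c: "c \<in> invariants scale A \<beta>"
  shows "class_ext g (c * a) = c * class_ext g a" "class_ext g (a * c) = class_ext g a * c"
proof -
  show "class_ext g (c * a) = c * class_ext g a"
  proof (rule class_ext_eqI[OF g])
    show "one r * (c * class_ext g a) = ext_map r (c * a)" if "r \<in> g" for r
      unfolding ext_invariant_mult[OF c] one_mult_class_ext[OF g that, symmetric]
      by (rule one_left_commute[symmetric])
  qed (simp add: ideal_sum_mult class_ext_mem g)
  show "class_ext g (a * c) = class_ext g a * c"
  proof (rule class_ext_eqI[OF g])
    show "one r * (class_ext g a * c) = ext_map r (a * c)" if "r \<in> g" for r
      unfolding ext_invariant_mult[OF c] one_mult_class_ext[OF g that, symmetric]
      by (rule mult.assoc[symmetric])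
  qed (simp add: ideal_sum_mult class_ext_mem g)
qed

text \<open>Let \<open>h = {r. sinv s * r \<in> g}\<close> be the class of \<open>s\<close> times \<open>g\<close>. Both sides lie in \<open>A s\<close> and in
  the sum over \<open>h\<close>, so only the products with \<open>one s * one r\<close> for \<open>r \<in> h\<close> matter. That product is
  \<open>one (s * t)\<close> for \<open>t = sinv s * r \<in> g\<close>, and pulling \<open>one (s * t)\<close> back along \<open>s\<close> gives
  \<open>ext_map s (one t * class_ext g a) = ext_map (s * t) a\<close>.\<close>

lemma ext_class_ext:
  assumes g: "g \<in> min_group"
  shows "ext_map s (class_ext g a) = one s * class_ext {r. sinv s * r \<in> g} a"
proof -
  let ?h = "{r. sinv s * r \<in> g}"
  have h: "?h \<in> min_group"
    using g by (rule min_group_vimage_left)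
  obtain x where x: "class_ext g a = (\<Sum>t\<in>g. ext_map t (x t))"
    using class_ext_family[OF g] by blast
  show ?thesis
  proof (rule ideal_sum_eqI[of ?h])
    have "s * t \<in> ?h" if "t \<in> g" for t
      using min_group_mult_sinv_left[OF g, of "sinv s" t] that by simp
    then show "ext_map s (class_ext g a) \<in> ideal_sum A ?h"
      unfolding x ext_sum ext_comp by (intro ideal_sum_sum ext_ideal_sum) simp_all
    show "one s * class_ext ?h a \<in> ideal_sum A ?h"
      by (intro ideal_sum_mult class_ext_mem h) simp
    fix r assume r: "r \<in> ?h"
    then have t: "sinv s * r \<in> g" by simp
    have "one s * ext_map s (class_ext g a) = ext_map s (class_ext g a)"
      using ext_mem mem_iff by blast
    then have "one r * ext_map s (class_ext g a) = one s * (one r * ext_map s (class_ext g a))"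
      using one_left_commute by metis
    also have "\<dots> = one (s * (sinv s * r)) * ext_map s (class_ext g a)"
      by (rule one_mult_one)
    also have "\<dots> = ext_map (s * (sinv s * r)) a"
      by (simp only: ext_mult_one one_mult_class_ext[OF g t] ext_comp)
    also have "\<dots> = one s * (one r * class_ext ?h a)"
      by (simp only: one_mult_class_ext[OF h r] one_mult_ext)
    finally show "one r * ext_map s (class_ext g a) = one r * (one s * class_ext ?h a)"
      by (simp only: one_left_commute[of "one r"])
  qed simp
qed

text \<open>Let \<open>h = {r. r * sinv s \<in> g}\<close> be \<open>g\<close> times the class of \<open>s\<close>. A family \<open>x\<close> over \<open>h\<close> that
  represents \<open>a\<close> yields the family \<open>ext_map s (x r)\<close>, which represents \<open>ext_map s a\<close> over \<open>g\<close> along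
  \<open>r \<mapsto> r * sinv s\<close>. Gluing gives one element \<open>c\<close> that satisfies the characterisation on both
  sides.\<close>

lemma class_ext_ext:
  assumes g: "g \<in> min_group" and a: "a \<in> A (sinv s)"
  shows "class_ext g (ext_map s a) = class_ext {r. r * sinv s \<in> g} a"
proof -
  let ?h = "{r. r * sinv s \<in> g}"
  have h: "?h \<in> min_group"
    using g by (rule min_group_vimage_right)
  obtain x where x: "\<forall>r\<in>?h. x r \<in> A (sinv r)" "a * dom_one ?h = sum x ?h"
    using class_ext_family[OF h] by blast
  define c where "c = (\<Sum>r\<in>?h. ext_map (r * sinv s) (ext_map s (x r)))"
  have c': "c = (\<Sum>r\<in>?h. ext_map r (one (sinv s) * x r))"
    by (simp add: c_def ext_comp ext_one_mult mult.assoc)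
  have "class_ext g (ext_map s a) = c"
  proof (rule class_ext_eqI[OF g])
    show "c \<in> ideal_sum A g"
      unfolding c_def by (intro ideal_sum_sum ext_ideal_sum) simp_all
    fix t assume t: "t \<in> g"
    have dom: "ext_map s (x r) \<in> A (sinv (r * sinv s))" if "r \<in> ?h" for r
      using x(1) that by (simp add: sinv_mult mem_iff ext_mult_one)
    have ts: "t * s \<in> ?h"
      using min_group_mult_sinv_right[OF g] t by (simp add: mult.assoc)
    have "one t * c = ext_map t (\<Sum>r\<in>?h. ext_map s (x r))"
      unfolding c_def using dom by (intro one_mult_sum_ext[OF g t]) auto
    also have "\<dots> = ext_map (t * s) (a * dom_one ?h)"
      by (simp add: ext_sum[symmetric] ext_comp x(2))
    also have "\<dots> = ext_map t (ext_map s a)"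
      by (simp add: ext_dom_one[OF h ts] ext_comp)
    finally show "one t * c = ext_map t (ext_map s a)" .
  qed
  moreover have "class_ext ?h a = c"
  proof (rule class_ext_eqI[OF h])
    show "c \<in> ideal_sum A ?h"
      unfolding c' by (intro ideal_sum_sum ext_ideal_sum) simp_all
    fix r assume r: "r \<in> ?h"
    \<comment> \<open>Multiplying by \<open>one (sinv s)\<close> does not change the represented element, as \<open>a \<in> A (sinv s)\<close>.\<close>
    have "one r * c = ext_map r (\<Sum>r\<in>?h. one (sinv s) * x r)"
      unfolding c' using x(1) by (intro one_mult_sum_ext[OF h r]) (auto intro: mult_mem_left)
    also have "\<dots> = ext_map r ((one (sinv s) * a) * dom_one ?h)"
      by (simp only: sum_distrib_left[symmetric] x(2)[symmetric] mult.assoc)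
    also have "\<dots> = ext_map r a"
      using a ext_dom_one[OF h r] by (simp add: mem_iff)
    finally show "one r * c = ext_map r a" .
  qed
  ultimately show ?thesis by simp
qed

lemma sigma_trace_bimodule_hom:
  "bimodule_hom_over (invariants scale A \<beta>) (sigma_trace A \<beta>)"
  unfolding bimodule_hom_over_def sigma_trace_eq sum_distrib_left sum_distrib_right
    sum.distrib[symmetric]
  by (auto intro!: sum.cong simp: class_ext_add class_ext_invariant_mult)

lemma sigma_trace_invariant: "sigma_trace A \<beta> a \<in> invariants scale A \<beta>"
  unfolding invariants_iff
proof
  fix s
  have "ext_map s (sigma_trace A \<beta> a)
      = (\<Sum>g\<in>min_group. one s * class_ext {r. sinv s * r \<in> g} a)"
    by (simp add: sigma_trace_eq ext_sum ext_class_ext)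
  also have "\<dots> = (\<Sum>g\<in>min_group. one s * class_ext g a)"
    by (rule sum.reindex_bij_betw[OF bij_betw_min_group_left])
  also have "\<dots> = one s * sigma_trace A \<beta> a"
    by (simp add: sigma_trace_eq sum_distrib_left)
  finally show "ext_map s (sigma_trace A \<beta> a) = one s * sigma_trace A \<beta> a" .
qed

lemma sigma_trace_map:
  assumes "a \<in> A (sinv s)"
  shows "sigma_trace A \<beta> (\<beta> s a) = sigma_trace A \<beta> a"
proof -
  have "sigma_trace A \<beta> (\<beta> s a) = (\<Sum>g\<in>min_group. class_ext {r. r * sinv s \<in> g} a)"
    by (simp add: sigma_trace_eq class_ext_ext[OF _ assms] ext_eq[OF assms, symmetric])
  also have "\<dots> = sigma_trace A \<beta> a"
    unfolding sigma_trace_eq by (rule sum.reindex_bij_betw[OF bij_betw_min_group_right])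
  finally show ?thesis .
qed

end


section \<open>The \<open>\<sigma>\<close>-trace theorem\<close>

theorem corollary3p4:
  fixes scale :: "'k::comm_ring_1 \<Rightarrow> 'a::ring \<Rightarrow> 'a"
    and A :: "'s::{e_unitary_inverse_semigroup, finite} \<Rightarrow> 'a set"
    and \<beta> :: "'s \<Rightarrow> 'a \<Rightarrow> 'a"
  assumes "inverse_semigroup_action scale A \<beta>"
    and "unital_action scale A"
    and "injective_action A \<beta>"
  shows "bimodule_hom_over (invariants scale A \<beta>) (sigma_trace A \<beta>) \<and>
    range (sigma_trace A \<beta>) \<subseteq> invariants scale A \<beta> \<and>
    (\<forall>s. \<forall>a\<in>A (sinv s). sigma_trace A \<beta> (\<beta> s a) = sigma_trace A \<beta> a)"
proof -
  interpret inverse_semigroup_action scale A \<beta>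
    by fact
  interpret finite_e_unitary_action scale A \<beta>
    by unfold_locales fact
  show ?thesis
    using sigma_trace_bimodule_hom sigma_trace_invariant sigma_trace_map by blast
qed

end
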